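(* Let $B$ be a bicyclic graph that does not possess any perfect matching. Then $B$ is not unimodular.
   Context: All graphs are finite, undirected and simple. A connected graph $B$ is bicyclic if $|E(B)|=|V(B)|+1$. $A(B)$ denotes the $0$-$1$ adjacency matrix of $B$; $B$ is unimodular if $\det A(B)\in\{-1,1\}$. A perfect matching is a spanning subgraph each of whose components is a $K_2$. *)

theory Defs
  imports
    "Graph_Theory.Graph_Theory"
    "Jordan_Normal_Form.Determinant"
begin

text \<open>
  A finite simple undirected graph is a \<^locale>\<open>pair_graph\<close>: a finite loop-free symmetric digraph
  without parallel arcs. Each undirected edge is thus represented by two opposite arcs, so edges are
  counted as unordered pairs.
\<close>

definition undirected_edges :: "'a pair_pre_digraph \<Rightarrow> 'a set set" where
  "undirected_edges G = (\<lambda>(u, v). {u, v}) ` parcs G"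

text \<open>The qualified name avoids the topological notion of the same name.\<close>

definition bicyclic :: "'a pair_pre_digraph \<Rightarrow> bool" where
  "bicyclic G \<longleftrightarrow> pair_graph G \<and> Digraph_Component.connected (with_proj G) \<and>
     card (undirected_edges G) = card (pverts G) + 1"

text \<open>
  In a symmetric digraph the strongly connected components (\<^const>\<open>pre_digraph.sccs\<close>, which are
  subgraphs and not just vertex sets) are the components of the underlying undirected graph.
\<close>

definition perfect_matching :: "'a pair_pre_digraph \<Rightarrow> 'a pair_pre_digraph \<Rightarrow> bool" where
  "perfect_matching M G \<longleftrightarrow> pair_graph M \<and> spanning (with_proj M) (with_proj G) \<and>
     (\<forall>C \<in> pre_digraph.sccs (with_proj M). K\<^bsub>2\<^esub> C)"

definition adjacency_matrix :: "'a list \<Rightarrow> 'a pair_pre_digraph \<Rightarrow> int mat" where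
  "adjacency_matrix vs G =
     mat (length vs) (length vs) (\<lambda>(i, j). if (vs ! i, vs ! j) \<in> parcs G then 1 else 0)"

text \<open>
  The list \<open>vs\<close> fixes the order of rows and columns. The determinant does not depend on it, so that
  in the definition of unimodularity \<open>some\<close> order could equally be \<open>every\<close> order.
\<close>

lemma det_adjacency_matrix_indep:
  assumes "distinct vs" "distinct ws" "set vs = set ws"
  shows "det (adjacency_matrix vs G) = det (adjacency_matrix ws G)"
proof -
  have "mset vs = mset ws"
    using assms set_eq_iff_mset_eq_distinct by blast
  then obtain p where p: "p permutes {..<length ws}" and vs: "permute_list p ws = vs"
    by (rule mset_eq_permutation)
  define n where "n = length ws"
  define A where "A = adjacency_matrix ws G"
  define B where "B = mat n n (\<lambda>(i, j). A $$ (p i, j))"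
  have p': "p permutes {0..<n}"
    using p by (simp add: n_def atLeast0LessThan)
  have lt: "p i < n" if "i < n" for i
    using permutes_in_image[OF p', of i] that by simp
  have A: "A \<in> carrier_mat n n" and B: "B \<in> carrier_mat n n"
    by (simp_all add: A_def B_def adjacency_matrix_def n_def)
  have "adjacency_matrix vs G = mat n n (\<lambda>(i, j). A $$ (p i, p j))"
    unfolding vs[symmetric] A_def adjacency_matrix_def
    using lt by (intro eq_matI) (auto simp: n_def permute_list_nth[OF p])
  also have "\<dots> = transpose_mat (mat n n (\<lambda>(i, j). transpose_mat B $$ (p i, j)))"
    using lt A by (intro eq_matI) (auto simp: B_def)
  also have "det \<dots> = det (mat n n (\<lambda>(i, j). transpose_mat B $$ (p i, j)))"
    by (rule det_transpose[of _ n]) simp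
  also have "\<dots> = signof p * det (transpose_mat B)"
    by (rule det_permute_rows[OF _ p']) (use B in simp)
  also have "det (transpose_mat B) = det B"
    by (rule det_transpose[OF B])
  also have "det B = signof p * det A"
    unfolding B_def by (rule det_permute_rows[OF A p'])
  also have "signof p * (signof p * det A) = det A"
    by (simp add: sign_def)
  finally show ?thesis
    by (simp add: A_def)
qed

definition unimodular :: "'a pair_pre_digraph \<Rightarrow> bool" where
  "unimodular G \<longleftrightarrow>
     (\<exists>vs. distinct vs \<and> set vs = pverts G \<and> det (adjacency_matrix vs G) \<in> {-1, 1})"

lemma unimodular_iff:
  assumes "distinct vs" "set vs = pverts G"
  shows "unimodular G \<longleftrightarrow> det (adjacency_matrix vs G) \<in> {-1, 1}"
  unfolding unimodular_def using assms det_adjacency_matrix_indep by metis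

end

theory Submission
  imports Defs
begin

text \<open>
  The reason is parity. Modulo 2 the signs in the Leibniz expansion of \<open>det A\<close> disappear, and for a
  symmetric matrix the terms of a permutation and of its inverse are equal. These terms cancel in
  pairs, so that modulo 2 only the involutions contribute. For an adjacency matrix the term of an
  involution is nonzero exactly when it maps every vertex to a neighbour. As there are no loops, such
  an involution moves every vertex, and its transpositions form a perfect matching. Hence a graph
  without a perfect matching has an even determinant, which is neither 1 nor -1.

  The linear algebra is \<open>symmetric_odd_det_imp_odd_involution\<close>. The passage from an involution to
  a spanning subgraph with components \<open>K\<^sub>2\<close> is \<open>perfect_matching_of_involution\<close>.
\<close>

text \<open>
  Over the orbits of the involution: an orbit with two elements contributes twice the same value.
\<close>

lemma even_sum_involution:
  fixes g :: "'b \<Rightarrow> int"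
  assumes "finite S"
    and f: "\<And>x. x \<in> S \<Longrightarrow> f x \<in> S" "\<And>x. x \<in> S \<Longrightarrow> f (f x) = x"
    and g: "\<And>x. x \<in> S \<Longrightarrow> g (f x) = g x"
    and fixed: "\<And>x. x \<in> S \<Longrightarrow> f x = x \<Longrightarrow> even (g x)"
  shows "even (sum g S)"
proof -
  define orb where "orb x = {x, f x}" for x
  have "sum g S = (\<Sum>Y \<in> orb ` S. \<Sum>x \<in> {x \<in> S. orb x = Y}. g x)"
    using \<open>finite S\<close> by (simp add: sum.group)
  moreover have "even (\<Sum>x \<in> {x \<in> S. orb x = Y}. g x)" if "Y \<in> orb ` S" for Y
  proof -
    obtain a where a: "a \<in> S" "Y = {a, f a}"
      using \<open>Y \<in> orb ` S\<close> by (auto simp: orb_def)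
    then have "{x \<in> S. orb x = Y} = {a, f a}"
      using f by (auto simp: orb_def doubleton_eq_iff)
    then show ?thesis
      using fixed[OF a(1)] g[OF a(1)] by (cases "f a = a") auto
  qed
  ultimately show ?thesis
    by (simp add: dvd_sum)
qed

text \<open>
  Were there no such involution, the fixed points of inversion on the symmetric group would all have
  even terms in the Leibniz expansion, and the other terms come in equal pairs by symmetry of \<open>A\<close>.
\<close>

lemma symmetric_odd_det_imp_odd_involution:
  fixes A :: "int mat"
  assumes A: "A \<in> carrier_mat n n"
    and sym: "\<And>i j. i < n \<Longrightarrow> j < n \<Longrightarrow> A $$ (i, j) = A $$ (j, i)"
    and "odd (det A)"
  shows "\<exists>p. p permutes {0..<n} \<and> (\<forall>i. p (p i) = i) \<and> (\<forall>i<n. odd (A $$ (i, p i)))"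
proof (rule ccontr)
  assume none: "\<not> ?thesis"
  define t where "t p = signof p * (\<Prod>i = 0..<n. A $$ (i, p i))" for p
  have "even (\<Sum>p \<in> {p. p permutes {0..<n}}. t p)"
    \<comment> \<open>\<open>inv_into UNIV\<close> is the inverse function; plain \<open>inv\<close> denotes the inverse in a group.\<close>
  proof (rule even_sum_involution[where f = "inv_into UNIV"])
    fix p assume "p \<in> {p. p permutes {0..<n}}"
    then have p: "p permutes {0..<n}" by simp
    show "inv_into UNIV p \<in> {p. p permutes {0..<n}}"
      using permutes_inv[OF p] by simp
    show "inv_into UNIV (inv_into UNIV p) = p"
      by (rule inv_inv_eq[OF permutes_bij[OF p]])
    have lt: "p i < n" if "i < n" for i
      using permutes_in_image[OF p, of i] that by simp
    have "(\<Prod>i = 0..<n. A $$ (i, inv_into UNIV p i)) = (\<Prod>i = 0..<n. A $$ (p i, inv_into UNIV p (p i)))"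
      by (rule prod.permute[OF p, unfolded comp_def])
    also have "\<dots> = (\<Prod>i = 0..<n. A $$ (i, p i))"
      using lt by (intro prod.cong) (auto simp: permutes_inverses[OF p] sym)
    finally show "t (inv_into UNIV p) = t p"
      by (simp add: t_def sign_inverse permutation_permutes[THEN iffD2] exI[of _ "{0..<n}"] p)
    assume "inv_into UNIV p = p"
    then have "p (p i) = i" for i
      using permutes_inverses(1)[OF p, of i] by simp
    then obtain i where "i < n" "even (A $$ (i, p i))"
      using none p by blast
    then have "even (\<Prod>i = 0..<n. A $$ (i, p i))"
      by (auto simp: even_prod_iff)
    then show "even (t p)"
      by (simp add: t_def)
  qed (simp add: finite_permutations)
  then show False
    using \<open>odd (det A)\<close> by (simp add: det_def'[OF A] t_def)
qed

text \<open>
  Exactly \<open>u\<close> and \<open>f u\<close> are reachable from \<open>u\<close> along the arcs \<open>(v, f v)\<close>, so the components are the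
  orbits of \<open>f\<close>; each has two vertices because \<open>G\<close> has no loops.
\<close>

lemma perfect_matching_of_involution:
  assumes "pair_graph G"
    and arc: "\<And>v. v \<in> pverts G \<Longrightarrow> (v, f v) \<in> parcs G"
    and inv: "\<And>v. v \<in> pverts G \<Longrightarrow> f (f v) = v"
  shows "perfect_matching \<lparr>pverts = pverts G, parcs = (\<lambda>v. (v, f v)) ` pverts G\<rparr> G"
proof -
  define M where "M = \<lparr>pverts = pverts G, parcs = (\<lambda>v. (v, f v)) ` pverts G\<rparr>"
  interpret G: pair_graph G by fact
  have in_verts: "f v \<in> pverts G" if "v \<in> pverts G" for v
    using G.in_arcsD2 arc[OF that] by blast
  have ne: "f v \<noteq> v" if "v \<in> pverts G" for v
    using G.pair_no_loops[OF arc[OF that]] by simp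
  have "symmetric (with_proj M)"
    using in_verts unfolding symmetric_def by (intro symI) (force simp: M_def inv)
  then interpret M: pair_graph M
    using in_verts ne by unfold_locales (auto simp: M_def dest: sym)
  have "spanning (with_proj M) (with_proj G)"
    unfolding spanning_def subgraph_def
    using arc M.wf_digraph_axioms G.wf_digraph_axioms by (auto simp: M_def)
  moreover have "K\<^bsub>2\<^esub> C" if C: "C \<in> M.sccs" for C
  proof -
    obtain u where uM: "u \<in> pverts M" and C_eq: "C = with_proj M \<restriction> M.scc_of u"
      using C by (auto simp: M.sccs_conv_sccs_verts M.sccs_verts_conv_scc_of)
    then have u: "u \<in> pverts G"
      by (simp add: M_def)
    have "(u, f u) \<in> parcs M" "(f u, u) \<in> parcs M"
      using u in_verts[OF u] inv[OF u] by (auto simp: M_def image_iff)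
    have "v \<in> {u, f u}" if "u \<rightarrow>\<^sup>*\<^bsub>with_proj M\<^esub> v" for v
      using that by (induction rule: M.reachable_induct) (auto simp: M_def inv u)
    moreover have "u \<rightarrow>\<^sup>*\<^bsub>with_proj M\<^esub> f u" "f u \<rightarrow>\<^sup>*\<^bsub>with_proj M\<^esub> u"
      using \<open>(u, f u) \<in> parcs M\<close> \<open>(f u, u) \<in> parcs M\<close> by auto
    ultimately have "M.scc_of u = {u, f u}"
      using M.reachable_refl[OF uM] by (auto simp: M.scc_of_def)
    moreover have "{e \<in> parcs M. fst e \<in> {u, f u} \<and> snd e \<in> {u, f u}} = {(u, f u), (f u, u)}"
      using u in_verts[OF u] inv[OF u] ne by (auto simp: M_def image_iff)
    ultimately have "C = with_proj \<lparr>pverts = {u, f u}, parcs = {(u, f u), (f u, u)}\<rparr>"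
      unfolding C_eq induce_subgraph_def by (simp add: with_proj_def)
    then show ?thesis
      using ne[OF u] by (auto simp: complete_digraph_pair_def)
  qed
  ultimately show ?thesis
    unfolding perfect_matching_def M_def[symmetric] using M.pair_graph_axioms by blast
qed

lemma unimodular_imp_perfect_matching:
  assumes "pair_graph G" "unimodular G"
  shows "\<exists>M. perfect_matching M G"
proof -
  interpret G: pair_graph G by fact
  obtain vs where vs: "distinct vs" "set vs = pverts G"
    and det: "det (adjacency_matrix vs G) \<in> {-1, 1}"
    using assms(2) unfolding unimodular_def by blast
  define n where "n = length vs"
  have entry: "adjacency_matrix vs G $$ (i, j) = (if (vs ! i, vs ! j) \<in> parcs G then 1 else 0)"
    if "i < n" "j < n" for i j
    using that by (simp add: adjacency_matrix_def n_def)
  have sym: "(u, v) \<in> parcs G \<longleftrightarrow> (v, u) \<in> parcs G" for u v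
    using G.graph_symmetric by blast
  have "adjacency_matrix vs G \<in> carrier_mat n n"
    by (simp add: adjacency_matrix_def n_def)
  moreover have "odd (det (adjacency_matrix vs G))"
    using det by auto
  moreover have "adjacency_matrix vs G $$ (i, j) = adjacency_matrix vs G $$ (j, i)"
    if "i < n" "j < n" for i j
    using that by (simp add: entry sym)
  ultimately obtain p where p: "p permutes {0..<n}" and pp: "\<And>i. p (p i) = i"
    and odd: "\<And>i. i < n \<Longrightarrow> odd (adjacency_matrix vs G $$ (i, p i))"
    using symmetric_odd_det_imp_odd_involution by blast
  have lt: "p i < n" if "i < n" for i
    using permutes_in_image[OF p, of i] that by simp
  \<comment> \<open>The involution \<open>p\<close> of indices, transported to the vertices along the enumeration \<open>vs\<close>.\<close>
  define idx where "idx = the_inv_into {..<n} ((!) vs)"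
  define f where "f v = vs ! p (idx v)" for v
  have inj: "inj_on ((!) vs) {..<n}"
    using vs(1) by (auto simp: inj_on_def n_def nth_eq_iff_index_eq)
  have f_nth: "f (vs ! i) = vs ! p i" if "i < n" for i
    using the_inv_into_f_f[OF inj, of i] that by (simp add: f_def idx_def)
  have verts: "\<exists>i<n. v = vs ! i" if "v \<in> pverts G" for v
    using that vs(2) by (metis in_set_conv_nth n_def)
  have "perfect_matching \<lparr>pverts = pverts G, parcs = (\<lambda>v. (v, f v)) ` pverts G\<rparr> G"
  proof (rule perfect_matching_of_involution[OF assms(1)])
    fix v assume "v \<in> pverts G"
    then obtain i where i: "i < n" "v = vs ! i"
      using verts by blast
    show "(v, f v) \<in> parcs G"
      using odd[OF i(1)] i lt by (auto simp: f_nth entry split: if_splits)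
    show "f (f v) = v"
      using i lt by (simp add: f_nth pp)
  qed
  then show ?thesis by blast
qed

theorem lemma2:
  fixes B :: "'a pair_pre_digraph"
  assumes "bicyclic B"
    and "\<nexists>M. perfect_matching M B"
  shows "\<not> unimodular B"
  using assms unimodular_imp_perfect_matching unfolding bicyclic_def by blast

end
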